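(* Let $K$ be a field. If $I$ is a squarefree monomial ideal in $K[x_1,\ldots,x_\ell]$ with big height $h\ge 2$, then $\rho(I)<h$ and $\widehat{\rho}(I)\le\frac{h\ell-1}{\ell}=h-\frac{1}{\ell}$.
   Context: For an ideal $I$ in a polynomial ring $R$ over a field and $s\ge 1$, the $s$-th symbolic power is $I^{(s)}=\bigcap_{P\in\mathrm{Ass}(I)}(I^sR_P\cap R)$, where $\mathrm{Ass}(I)$ is the set of all associated primes of $I$ (i.e. of $R/I$); $I^{(0)}=R$. The big height of $I$ is the maximum height of an associated prime of $I$. The resurgence is $\rho(I)=\sup\{\frac{s}{r} : I^{(s)}\not\subset I^r\}$, and the asymptotic resurgence is $\widehat{\rho}(I)=\sup\{\frac{s}{r} : I^{(st)}\not\subset I^{rt}\text{ for all }t\gg 0\}$. *)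

theory Defs
  imports Complex_Main "HOL-Library.Poly_Mapping" "HOL-Library.Extended_Nat"
    "HOL-Library.Extended_Real" "HOL-Library.Cardinality"
begin

section \<open>Ideals\<close>

text \<open>The ideals of a commutative ring are the submodules of the ring acting on itself.\<close>

global_interpretation ideal: module "(*) :: 'a::comm_ring_1 \<Rightarrow> 'a \<Rightarrow> 'a"
  by unfold_locales (simp_all add: algebra_simps)

definition ideal_mult :: "'a::comm_ring_1 set \<Rightarrow> 'a set \<Rightarrow> 'a set" where
  "ideal_mult I J = ideal.span {a * b | a b. a \<in> I \<and> b \<in> J}"

primrec ideal_power :: "'a::comm_ring_1 set \<Rightarrow> nat \<Rightarrow> 'a set" where
  "ideal_power I 0 = UNIV"
| "ideal_power I (Suc s) = ideal_mult I (ideal_power I s)"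

definition is_prime_ideal :: "'a::comm_ring_1 set \<Rightarrow> bool" where
  "is_prime_ideal P \<longleftrightarrow> ideal.subspace P \<and> P \<noteq> UNIV \<and>
     (\<forall>a b. a * b \<in> P \<longrightarrow> a \<in> P \<or> b \<in> P)"

text \<open>\<open>Ass(I)\<close>: the primes that are the annihilator \<open>I : f\<close> of some element \<open>f + I\<close> of \<open>R/I\<close>.\<close>

definition associated_primes :: "'a::comm_ring_1 set \<Rightarrow> 'a set set" where
  "associated_primes I = {P. is_prime_ideal P \<and> (\<exists>f. P = {a. a * f \<in> I})}"

definition ideal_height :: "'a::comm_ring_1 set \<Rightarrow> enat" where
  "ideal_height P = Sup {enat n | n. \<exists>c :: nat \<Rightarrow> 'a set.
     (\<forall>i\<le>n. is_prime_ideal (c i)) \<and> (\<forall>i<n. c i \<subset> c (Suc i)) \<and> c n = P}"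

text \<open>A supremum of finite value over a nonempty set of extended naturals is a maximum. The unit
  ideal, which has no associated primes, gets the value \<open>0\<close>.\<close>

definition big_height :: "'a::comm_ring_1 set \<Rightarrow> enat" where
  "big_height I = Sup (ideal_height ` associated_primes I)"

section \<open>Localization at a prime and symbolic powers\<close>

text \<open>A pair \<open>(a, u)\<close> stands for the fraction \<open>a/u\<close>; the ring \<open>R\<^sub>P\<close> consists of the classes of
  \<open>local_frac_rel P\<close> on the pairs with \<open>u \<notin> P\<close>.\<close>

definition local_frac_rel :: "'a::comm_ring_1 set \<Rightarrow> (('a \<times> 'a) \<times> ('a \<times> 'a)) set" where
  "local_frac_rel P = {((a, u), (b, v)). u \<notin> P \<and> v \<notin> P \<and>
     (\<exists>t. t \<notin> P \<and> t * (a * v - b * u) = 0)}"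

definition local_frac :: "'a::comm_ring_1 set \<Rightarrow> 'a \<Rightarrow> 'a \<Rightarrow> ('a \<times> 'a) set" where
  "local_frac P a u = local_frac_rel P `` {(a, u)}"

definition localized_ideal :: "'a::comm_ring_1 set \<Rightarrow> 'a set \<Rightarrow> ('a \<times> 'a) set set" where
  "localized_ideal P J = {local_frac P a u | a u. a \<in> J \<and> u \<notin> P}"

text \<open>\<open>J R\<^sub>P \<inter> R\<close>, that is, the preimage of \<open>J R\<^sub>P\<close> under the canonical map \<open>f \<mapsto> f/1\<close>.\<close>

definition localized_contraction :: "'a::comm_ring_1 set \<Rightarrow> 'a set \<Rightarrow> 'a set" where
  "localized_contraction P J = {f. local_frac P f 1 \<in> localized_ideal P J}"

definition symbolic_power :: "'a::comm_ring_1 set \<Rightarrow> nat \<Rightarrow> 'a set" where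
  "symbolic_power I s = (\<Inter>P\<in>associated_primes I. localized_contraction P (ideal_power I s))"

section \<open>Resurgence\<close>

definition resurgence :: "'a::comm_ring_1 set \<Rightarrow> ereal" where
  "resurgence I = Sup {ereal (real s / real r) | s r.
     s \<ge> 1 \<and> r \<ge> 1 \<and> \<not> symbolic_power I s \<subseteq> ideal_power I r}"

definition asymptotic_resurgence :: "'a::comm_ring_1 set \<Rightarrow> ereal" where
  "asymptotic_resurgence I = Sup {ereal (real s / real r) | s r.
     s \<ge> 1 \<and> r \<ge> 1 \<and>
     (\<forall>\<^sub>F t in sequentially. \<not> symbolic_power I (s * t) \<subseteq> ideal_power I (r * t))}"

section \<open>Squarefree monomial ideals\<close>

text \<open>\<open>('n, 'k) mpoly\<close> is the polynomial ring over \<open>'k\<close> with one variable for each element of \<open>'n\<close>: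
  finitely supported functions from exponent vectors to coefficients, under convolution.\<close>

type_synonym ('n, 'k) mpoly = "('n \<Rightarrow>\<^sub>0 nat) \<Rightarrow>\<^sub>0 'k"

definition monomial :: "('n \<Rightarrow>\<^sub>0 nat) \<Rightarrow> ('n, 'k::comm_ring_1) mpoly" where
  "monomial m = Poly_Mapping.single m 1"

definition squarefree_monomial_ideal :: "('n, 'k::comm_ring_1) mpoly set \<Rightarrow> bool" where
  "squarefree_monomial_ideal I \<longleftrightarrow>
     (\<exists>M. (\<forall>m\<in>M. \<forall>i. Poly_Mapping.lookup m i \<le> 1) \<and> I = ideal.span (monomial ` M))"

end

theory Submission
  imports Defs
begin

text \<open>
  Let \<open>\<ell>\<close> be the number of variables and let \<open>E\<close> consist of the supports of the squarefree generators
  of \<open>I\<close>. For every minimal vertex cover \<open>F\<close> of the hypergraph \<open>E\<close>, the ideal \<open>P\<^sub>F\<close> generated by the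
  variables in \<open>F\<close> is an associated prime of \<open>I\<close> of height at least \<open>card F\<close>. So all minimal covers
  have at most \<open>h\<close> elements, and since the powers of \<open>P\<^sub>F\<close> are primary, a monomial with exponents \<open>a\<close>
  that occurs in an element of \<open>I\<^sup>(\<^sup>s\<^sup>)\<close> satisfies \<open>sum a F \<ge> s\<close> for every minimal cover \<open>F\<close>. It lies in
  \<open>I\<^sup>r\<close> as soon as \<open>r\<close> edges, counted with repetition, contain each variable \<open>i\<close> at most \<open>a i\<close> times.
  What remains is to find such edges, and three arguments do it.

  \<^item> If \<open>s > h (r - 1)\<close>, then every minimal cover contains a variable of exponent at least \<open>r\<close>, so the
    variables of smaller exponent do not form a cover: some edge avoids them all and can be used \<open>r\<close>
    times (\<open>edge_of_large_weights\<close>).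

  \<^item> If \<open>r = \<ell>\<close>, then \<open>s = h (\<ell> - 1)\<close> suffices, one less than above, provided that
    \<open>h, \<ell> \<ge> 2\<close> (\<open>edges_within_weights\<close>). The only obstruction to the previous argument is a cover
    of \<open>h\<close> variables that all have exponent exactly \<open>\<ell> - 1\<close>. As no single variable of exponent
    \<open>\<ell> - 1\<close> can then complete the variables of smaller exponent to a cover, every variable \<open>v\<close> has an edge
    avoiding the small exponents and, if \<open>v\<close> has exponent \<open>\<ell> - 1\<close>, avoiding \<open>v\<close> as well. Taking one
    such edge for each of the \<open>\<ell>\<close> variables uses \<open>v\<close> at most \<open>\<ell> - 1\<close> times.

  \<^item> Rounding \<open>a / n\<close> down costs at most \<open>(n - 1) / n\<close> per variable, hence at most \<open>h (n - 1)\<close> in the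
    weight of a cover before division by \<open>n\<close>. So the previous case gives
    \<open>I\<^sup>(\<^sup>s\<^sup>) \<subseteq> I\<^bsup>n \<ell>\<^esup>\<close> whenever \<open>n \<ge> 1\<close> and \<open>s > n (h \<ell> - 1) - h\<close>
    (\<open>edges_within_scaled_weights\<close>).

  The last containment bounds the asymptotic resurgence by \<open>(h \<ell> - 1) / \<ell>\<close>: if \<open>s / r\<close> is larger, then
  \<open>I\<^sup>(\<^sup>s\<^sup>t\<^sup>) \<subseteq> I\<^sup>r\<^sup>t\<close> for all multiples \<open>t > 0\<close> of \<open>\<ell>\<close>. For the resurgence, a pair with
  \<open>I\<^sup>(\<^sup>s\<^sup>) \<not>\<subseteq> I\<^sup>r\<close> satisfies \<open>s \<le> h r - h\<close> by the first containment, which is the stronger one for small \<open>r\<close>, and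
  \<open>\<ell> s \<le> (h \<ell> - 1) r + const\<close> by the last one, which is the stronger one for large \<open>r\<close>. A positive combination
  of the two eliminates the constant and gives \<open>s / r \<le> h - 1 / (\<ell> + \<ell>\<^sup>2)\<close>.
  If \<open>\<ell> = 1\<close>, then covers have at most one element, and the pigeonhole argument gives
  \<open>I\<^sup>(\<^sup>s\<^sup>) \<subseteq> I\<^sup>r\<close> for all \<open>s \<ge> r \<ge> 1\<close>, which bounds both suprema by \<open>1 \<le> h - 1\<close>.
\<close>

section \<open>Vertex covers of a hypergraph\<close>

definition vertex_cover :: "'n set set \<Rightarrow> 'n set \<Rightarrow> bool" where
  "vertex_cover E F \<longleftrightarrow> (\<forall>e\<in>E. e \<inter> F \<noteq> {})"

definition minimal_cover :: "'n set set \<Rightarrow> 'n set \<Rightarrow> bool" where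
  "minimal_cover E F \<longleftrightarrow> vertex_cover E F \<and> (\<forall>G\<subset>F. \<not> vertex_cover E G)"

lemma vertex_cover_contains_minimal:
  fixes F :: "'n::finite set"
  assumes "vertex_cover E F"
  obtains G where "G \<subseteq> F" "minimal_cover E G"
proof -
  have "\<exists>G\<subseteq>F. minimal_cover E G"
    using finite[of F] assms
  proof (induction F rule: finite_psubset_induct)
    case (psubset F)
    then show ?case
      unfolding minimal_cover_def by (meson order_refl psubset_imp_subset subset_trans)
  qed
  with that show thesis by blast
qed

lemma edge_avoiding_or_minimal_cover:
  fixes W :: "'n::finite set"
  obtains e where "e \<in> E" "e \<inter> W = {}" | F where "F \<subseteq> W" "minimal_cover E F"
  using vertex_cover_contains_minimal unfolding vertex_cover_def by metis

text \<open>An edge that meets \<open>F\<close> only in \<open>i\<close> is what prevents \<open>i\<close> from being removed.\<close>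

lemma minimal_cover_private_edge:
  assumes "minimal_cover E F" "i \<in> F"
  obtains e where "e \<in> E" "e \<inter> F = {i}"
proof -
  have "vertex_cover E F" "\<not> vertex_cover E (F - {i})"
    using assms unfolding minimal_cover_def by (auto simp: psubset_eq)
  then show thesis
    using that unfolding vertex_cover_def by blast
qed

section \<open>Edges below an exponent vector\<close>

text \<open>Pigeonhole: in a cover of at most \<open>k\<close> elements with weight above \<open>k * (r - 1)\<close>, some element has
  weight at least \<open>r\<close>.\<close>

lemma edge_of_large_weights:
  fixes a :: "'n::finite \<Rightarrow> nat"
  assumes small: "\<And>F. minimal_cover E F \<Longrightarrow> card F \<le> k"
    and weight: "\<And>F. minimal_cover E F \<Longrightarrow> k * (r - 1) + 1 \<le> sum a F"
    and "1 \<le> r"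
  obtains e where "e \<in> E" "\<And>i. i \<in> e \<Longrightarrow> r \<le> a i"
proof (cases rule: edge_avoiding_or_minimal_cover[of E "{i. a i < r}"])
  case (1 e)
  then have "r \<le> a i" if "i \<in> e" for i
    using that by (force simp: disjoint_iff)
  with 1(1) show thesis using that by blast
next
  case (2 F)
  have "sum a F \<le> card F * (r - 1)"
    using sum_bounded_above[of F a "r - 1"] 2(1) by (force simp: subset_iff)
  also have "\<dots> \<le> k * (r - 1)"
    using small[OF 2(2)] by simp
  finally show thesis using weight[OF 2(2)] by simp
qed

text \<open>This saves one unit of weight over the pigeonhole bound. The set \<open>W v\<close> below consists of what the
  edge chosen for \<open>v\<close> has to avoid: it must miss the weights below \<open>CARD('n) - 1\<close>, and it must miss
  \<open>v\<close> itself if \<open>v\<close> has weight \<open>CARD('n) - 1\<close>, because \<open>v\<close> may be used by the edges of the other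
  variables only. A minimal cover inside \<open>W v\<close> would have at most one element of weight
  \<open>CARD('n) - 1\<close> and no heavier ones, which is too light for \<open>k \<ge> 2\<close>.\<close>

lemma edges_within_weights:
  fixes a :: "'n::finite \<Rightarrow> nat"
  assumes small: "\<And>F. minimal_cover E F \<Longrightarrow> card F \<le> k"
    and weight: "\<And>F. minimal_cover E F \<Longrightarrow> k * (CARD('n) - 1) \<le> sum a F"
    and k: "2 \<le> k" and two: "2 \<le> CARD('n)"
  obtains e :: "'n \<Rightarrow> 'n set" where "\<And>v. e v \<in> E" "\<And>i. card {v. i \<in> e v} \<le> a i"
proof -
  define l where "l = CARD('n)"
  define W where "W v = {i. a i < l - 1} \<union> (if a v = l - 1 then {v} else {})" for v
  have "\<exists>e\<in>E. e \<inter> W v = {}" for v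
  proof (cases rule: edge_avoiding_or_minimal_cover[of E "W v"])
    case (2 F)
    have F: "a i \<le> l - 1" if "i \<in> F" for i
      using that 2(1) by (auto simp: W_def split: if_splits)
    have "sum a F < k * (l - 1)"
    proof (cases "F \<subseteq> {v}")
      case True
      then have "sum a F \<le> l - 1"
        using F by (auto simp: subset_singleton_iff)
      also have "\<dots> < k * (l - 1)"
        using k two by (simp add: l_def)
      finally show ?thesis .
    next
      case False
      then obtain j where j: "j \<in> F" "j \<noteq> v" by auto
      then have "a j < l - 1"
        using 2(1) by (auto simp: W_def split: if_splits)
      then have "sum a F < (\<Sum>i\<in>F. l - 1)"
        using F j by (intro sum_strict_mono_ex1) auto
      also have "\<dots> \<le> k * (l - 1)"
        using small[OF 2(2)] by simp
      finally show ?thesis .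
    qed
    with weight[OF 2(2)] show ?thesis by (simp add: l_def)
  qed auto
  then obtain e where e: "\<And>v. e v \<in> E" "\<And>v. e v \<inter> W v = {}" by metis
  have "card {v. i \<in> e v} \<le> a i" for i
  proof -
    consider "a i < l - 1" | "a i = l - 1" | "l \<le> a i" by linarith
    then show ?thesis
    proof cases
      case 1
      then have "{v. i \<in> e v} = {}" using e(2) by (force simp: W_def)
      then show ?thesis by simp
    next
      case 2
      then have "{v. i \<in> e v} \<subseteq> UNIV - {i}" using e(2)[of i] by (auto simp: W_def)
      then have "card {v. i \<in> e v} \<le> card (UNIV - {i})" by (intro card_mono) auto
      then show ?thesis using 2 by (simp add: l_def)
    next
      case 3
      have "card {v. i \<in> e v} \<le> l" unfolding l_def by (intro card_mono) auto
      with 3 show ?thesis by simp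
    qed
  qed
  with e(1) that show thesis by blast
qed

text \<open>The previous lemma applies to the weights \<open>a i div n\<close>. The remainders take at most \<open>k * (n - 1)\<close> away
  from the weight of a cover, and \<open>n * (k * CARD('n) - 1) - k - k * (n - 1)\<close> equals
  \<open>n * (k * (CARD('n) - 1) - 1)\<close>; the strict inequality makes up for the final \<open>- 1\<close>.\<close>

lemma edges_within_scaled_weights:
  fixes a :: "'n::finite \<Rightarrow> nat"
  assumes small: "\<And>F. minimal_cover E F \<Longrightarrow> card F \<le> k"
    and weight: "\<And>F. minimal_cover E F \<Longrightarrow> n * (k * CARD('n) - 1) + 1 \<le> sum a F + k"
    and k: "2 \<le> k" and two: "2 \<le> CARD('n)" and n: "1 \<le> n"
  obtains e :: "'n \<Rightarrow> 'n set" where "\<And>v. e v \<in> E" "\<And>i. n * card {v. i \<in> e v} \<le> a i"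
proof (rule edges_within_weights[of E k "\<lambda>i. a i div n"])
  fix F assume F: "minimal_cover E F"
  define q where "q = (\<Sum>i\<in>F. a i div n)"
  have "sum a F = n * q + (\<Sum>i\<in>F. a i mod n)"
    by (simp add: q_def sum_distrib_left flip: sum.distrib)
  also have "(\<Sum>i\<in>F. a i mod n) \<le> card F * (n - 1)"
    using sum_bounded_above[of F "\<lambda>i. a i mod n" "n - 1"] n
    by (simp add: Suc_leI less_eq_nat.simps flip: less_Suc_eq_le)
  also have "card F * (n - 1) \<le> k * (n - 1)" using small[OF F] by simp
  finally have "n * (k * CARD('n) - 1) + 1 \<le> n * q + k * (n - 1) + k"
    using weight[OF F] by simp
  also have "\<dots> = n * (q + k)" using n by (cases n) (auto simp: algebra_simps)
  finally have "n * (k * CARD('n) - 1) < n * (q + k)" by linarith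
  then have "k * CARD('n) - 1 < q + k" using mult_less_cancel1 by blast
  then show "k * (CARD('n) - 1) \<le> (\<Sum>i\<in>F. a i div n)"
    by (simp add: q_def diff_mult_distrib2)
next
  fix e :: "'n \<Rightarrow> 'n set"
  assume e: "\<And>v. e v \<in> E" "\<And>i. card {v. i \<in> e v} \<le> a i div n"
  show thesis
  proof (rule that[of e])
    show "n * card {v. i \<in> e v} \<le> a i" for i
      using e(2)[of i] by (meson le_trans mult_le_mono2 times_div_less_eq_dividend)
  qed (rule e(1))
qed (use assms in auto)

section \<open>Monomials in ideals and their powers\<close>

definition deg_in :: "'n set \<Rightarrow> ('n \<Rightarrow>\<^sub>0 nat) \<Rightarrow> nat" where
  "deg_in F m = (\<Sum>i\<in>F. Poly_Mapping.lookup m i)"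

text \<open>The \<open>s\<close>-th power of the prime ideal generated by the variables in \<open>F\<close>, described by its
  monomials.\<close>

definition variable_power :: "'n set \<Rightarrow> nat \<Rightarrow> ('n, 'k::comm_ring_1) mpoly set" where
  "variable_power F s = {f. \<forall>m\<in>Poly_Mapping.keys f. s \<le> deg_in F m}"

lemma deg_in_add: "deg_in F (a + b) = deg_in F a + deg_in F b"
  by (simp add: deg_in_def lookup_add sum.distrib)

lemma keys_monomial [simp]: "Poly_Mapping.keys (monomial m :: ('n, 'k::comm_ring_1) mpoly) = {m}"
  by (simp add: monomial_def)

lemma monomial_mult: "monomial (a + b) = monomial a * monomial b"
  by (simp add: monomial_def mult_single)

lemma subspace_keys_all:
  assumes "\<And>m u. P m \<Longrightarrow> P (u + m)"
  shows "ideal.subspace {f :: ('n, 'k::comm_ring_1) mpoly. \<forall>m\<in>Poly_Mapping.keys f. P m}"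
proof (rule ideal.subspaceI)
  fix f g :: "('n, 'k) mpoly"
  assume "f \<in> {f. \<forall>m\<in>Poly_Mapping.keys f. P m}" "g \<in> {f. \<forall>m\<in>Poly_Mapping.keys f. P m}"
  then show "f + g \<in> {f. \<forall>m\<in>Poly_Mapping.keys f. P m}"
    using keys_add[of f g] by blast
next
  fix c f :: "('n, 'k) mpoly"
  assume "f \<in> {f. \<forall>m\<in>Poly_Mapping.keys f. P m}"
  then show "c * f \<in> {f. \<forall>m\<in>Poly_Mapping.keys f. P m}"
    using keys_mult[of c f] assms by blast
qed simp

lemma mpoly_eq_sum_monomials:
  fixes f :: "('n, 'k::comm_ring_1) mpoly"
  shows "f = (\<Sum>m\<in>Poly_Mapping.keys f. Poly_Mapping.single 0 (Poly_Mapping.lookup f m) * monomial m)"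
proof (rule poly_mapping_eqI)
  fix u
  show "Poly_Mapping.lookup f u = Poly_Mapping.lookup
    (\<Sum>m\<in>Poly_Mapping.keys f. Poly_Mapping.single 0 (Poly_Mapping.lookup f m) * monomial m) u"
    by (simp add: lookup_sum monomial_def mult_single lookup_single when_def in_keys_iff)
qed

lemma mem_subspace_if_monomials:
  fixes f :: "('n, 'k::comm_ring_1) mpoly"
  assumes "ideal.subspace J" "\<And>m. m \<in> Poly_Mapping.keys f \<Longrightarrow> monomial m \<in> J"
  shows "f \<in> J"
  by (subst mpoly_eq_sum_monomials[of f])
    (intro ideal.subspace_sum[OF assms(1)] ideal.subspace_scale[OF assms(1)] assms(2))

lemma monomial_multiple_mem:
  assumes "ideal.subspace J" "(monomial g :: ('n, 'k::comm_ring_1) mpoly) \<in> J"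
    and "\<And>i. Poly_Mapping.lookup g i \<le> Poly_Mapping.lookup m i"
  shows "(monomial m :: ('n, 'k) mpoly) \<in> J"
proof -
  have "m = (m - g) + g"
    using assms(3) by (intro poly_mapping_eqI) (simp add: lookup_add lookup_minus)
  then have "monomial m = monomial (m - g) * (monomial g :: ('n, 'k) mpoly)"
    by (metis monomial_mult)
  then show ?thesis
    using ideal.subspace_scale[OF assms(1,2)] by simp
qed

lemma mem_span_monomials_iff:
  fixes f :: "('n, 'k::comm_ring_1) mpoly"
  shows "f \<in> ideal.span (monomial ` M) \<longleftrightarrow>
    (\<forall>m\<in>Poly_Mapping.keys f. \<exists>g\<in>M. \<forall>i. Poly_Mapping.lookup g i \<le> Poly_Mapping.lookup m i)"
    (is "_ \<longleftrightarrow> (\<forall>m\<in>_. ?P m)")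
proof
  have "?P (u + m)" if "?P m" for u m
    using that by (metis lookup_add trans_le_add2)
  then have "ideal.subspace {f :: ('n, 'k) mpoly. \<forall>m\<in>Poly_Mapping.keys f. ?P m}"
    by (rule subspace_keys_all)
  then have "ideal.span (monomial ` M) \<subseteq> {f :: ('n, 'k) mpoly. \<forall>m\<in>Poly_Mapping.keys f. ?P m}"
    by (rule ideal.span_minimal[rotated]) auto
  then show "f \<in> ideal.span (monomial ` M) \<Longrightarrow> \<forall>m\<in>Poly_Mapping.keys f. ?P m"
    by blast
next
  assume P: "\<forall>m\<in>Poly_Mapping.keys f. ?P m"
  show "f \<in> ideal.span (monomial ` M)"
  proof (rule mem_subspace_if_monomials)
    fix m assume "m \<in> Poly_Mapping.keys f"
    with P obtain g where g: "g \<in> M" "\<And>i. Poly_Mapping.lookup g i \<le> Poly_Mapping.lookup m i"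
      by blast
    show "monomial m \<in> ideal.span (monomial ` M)"
      by (rule monomial_multiple_mem[OF ideal.subspace_span ideal.span_base[OF imageI[OF g(1), where f = monomial]] g(2)])
  qed simp
qed

lemma subspace_ideal_power: "ideal.subspace (ideal_power I r)"
  by (cases r) (simp_all add: ideal_mult_def)

lemma ideal_power_antimono: 
  assumes "r \<le> s" shows "ideal_power I s \<subseteq> ideal_power I r"
proof -
  have "ideal_power I (Suc n) \<subseteq> ideal_power I n" for n
    using subspace_ideal_power[of I n] unfolding ideal_power.simps ideal_mult_def
    by (intro ideal.span_minimal) (auto intro: ideal.subspace_scale)
  then show ?thesis using assms lift_Suc_antimono_le by blast
qed

lemma monomial_sum_list_mem_ideal_power:
  assumes "\<And>g. g \<in> set gs \<Longrightarrow> monomial g \<in> I"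
  shows "monomial (sum_list gs) \<in> ideal_power I (length gs)"
  using assms
proof (induction gs)
  case (Cons g gs)
  then have "monomial g * monomial (sum_list gs) \<in> ideal_mult I (ideal_power I (length gs))"
    unfolding ideal_mult_def by (intro ideal.span_base) auto
  then show ?case by (simp add: monomial_mult)
qed simp

lemma subspace_variable_power: "ideal.subspace (variable_power F s)"
  unfolding variable_power_def by (rule subspace_keys_all) (simp add: deg_in_add)

lemma variable_power_mult:
  assumes "f \<in> variable_power F c" "g \<in> variable_power F d"
  shows "f * g \<in> variable_power F (c + d)"
  unfolding variable_power_def
proof safe
  fix m assume "m \<in> Poly_Mapping.keys (f * g)"
  then obtain a b where "m = a + b" "a \<in> Poly_Mapping.keys f" "b \<in> Poly_Mapping.keys g"
    using keys_mult by blast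
  then show "c + d \<le> deg_in F m"
    using assms by (auto simp: variable_power_def deg_in_add intro: add_mono)
qed

lemma ideal_power_subset_variable_power:
  assumes "I \<subseteq> variable_power F 1"
  shows "ideal_power I s \<subseteq> variable_power F s"
proof (induction s)
  case (Suc s)
  have "{a * b | a b. a \<in> I \<and> b \<in> ideal_power I s} \<subseteq> variable_power F (Suc s)"
    using variable_power_mult[of _ F 1 _ s] assms Suc by auto
  then show ?case
    unfolding ideal_power.simps ideal_mult_def
    by (intro ideal.span_minimal subspace_variable_power)
qed (auto simp: variable_power_def)

section \<open>Powers of variable ideals are primary\<close>

text \<open>A pair of parts \<open>A'\<close> and \<open>B'\<close> of the exponent sets of two polynomials such that the product of
  the corresponding partial polynomials suffers no cancellation from the remaining terms, as for a
  face of a Minkowski sum.\<close>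

definition sum_face ::
    "'a::plus set \<Rightarrow> 'a set \<Rightarrow> 'a set \<Rightarrow> 'a set \<Rightarrow> bool" where
  "sum_face A B A' B' \<longleftrightarrow> A' \<noteq> {} \<and> B' \<noteq> {} \<and> A' \<subseteq> A \<and> B' \<subseteq> B \<and>
    (\<forall>a\<in>A. \<forall>b\<in>B. \<forall>a'\<in>A'. \<forall>b'\<in>B'. a + b = a' + b' \<longrightarrow> a \<in> A' \<and> b \<in> B')"

text \<open>Additivity forces both summands of a minimal sum to be minimal, so the minimizers of an additive
  function form a face.\<close>

lemma sum_face_minimizers:
  fixes \<phi> :: "'a::plus \<Rightarrow> nat"
  assumes "sum_face A B A' B'" and add: "\<And>a b. \<phi> (a + b) = \<phi> a + \<phi> b"
  obtains A'' B'' where "sum_face A B A'' B''" "A'' \<subseteq> A'" "B'' \<subseteq> B'"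
    "\<And>a a'. a \<in> A'' \<Longrightarrow> a' \<in> A' \<Longrightarrow> \<phi> a \<le> \<phi> a'"
    "\<And>b b'. b \<in> B'' \<Longrightarrow> b' \<in> B' \<Longrightarrow> \<phi> b \<le> \<phi> b'"
proof -
  define A'' where "A'' = {a\<in>A'. \<forall>a'\<in>A'. \<phi> a \<le> \<phi> a'}"
  define B'' where "B'' = {b\<in>B'. \<forall>b'\<in>B'. \<phi> b \<le> \<phi> b'}"
  have "\<exists>x. x \<in> X \<and> (\<forall>y\<in>X. \<phi> x \<le> \<phi> y)" if "X \<noteq> {}" for X :: "'a set"
    using that ex_has_least_nat[of "\<lambda>x. x \<in> X" _ \<phi>] by blast
  then have "A'' \<noteq> {}" "B'' \<noteq> {}"
    using assms(1) by (auto simp: A''_def B''_def sum_face_def)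
  moreover have "a \<in> A'' \<and> b \<in> B''"
    if *: "a \<in> A" "b \<in> B" "a' \<in> A''" "b' \<in> B''" "a + b = a' + b'" for a b a' b'
  proof -
    have "a' \<in> A'" "b' \<in> B'"
      using * by (auto simp: A''_def B''_def)
    then have ab: "a \<in> A'" "b \<in> B'"
      using *(1,2,5) assms(1) unfolding sum_face_def by blast+
    have "\<phi> a + \<phi> b = \<phi> a' + \<phi> b'"
      using *(5) by (metis add)
    moreover have "\<phi> a' \<le> \<phi> a" "\<phi> b' \<le> \<phi> b"
      using * ab by (auto simp: A''_def B''_def)
    ultimately have "\<phi> a = \<phi> a'" "\<phi> b = \<phi> b'" by linarith+
    then show ?thesis
      using * ab by (auto simp: A''_def B''_def)
  qed
  moreover have "A'' \<subseteq> A'" "B'' \<subseteq> B'" by (auto simp: A''_def B''_def)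
  moreover have "A' \<subseteq> A" "B' \<subseteq> B" using assms(1) by (simp_all add: sum_face_def)
  ultimately have "sum_face A B A'' B''"
    unfolding sum_face_def by (meson subset_trans)
  then show thesis
    by (rule that) (simp_all add: A''_def B''_def)
qed

text \<open>First restrict to the exponents of least degree in \<open>F\<close>, then to those minimal in each coordinate in
  turn. Each step passes to a face, and at the end all coordinates are constant, which leaves one
  exponent on each side. This replaces a monomial order, for which the variables would have to be
  ordered.\<close>

lemma unique_sum_of_least_degree:
  fixes A B :: "('n::finite \<Rightarrow>\<^sub>0 nat) set"
  assumes "A \<noteq> {}" "B \<noteq> {}"
  obtains a b where "a \<in> A" "b \<in> B"
    "\<And>a' b'. a' \<in> A \<Longrightarrow> b' \<in> B \<Longrightarrow> a' + b' = a + b \<Longrightarrow> a' = a \<and> b' = b"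
    "\<And>a'. a' \<in> A \<Longrightarrow> deg_in F a \<le> deg_in F a'"
    "\<And>b'. b' \<in> B \<Longrightarrow> deg_in F b \<le> deg_in F b'"
proof -
  have "sum_face A B A B"
    using assms by (simp add: sum_face_def)
  then obtain A0 B0 where 0: "sum_face A B A0 B0"
    "\<And>a a'. a \<in> A0 \<Longrightarrow> a' \<in> A \<Longrightarrow> deg_in F a \<le> deg_in F a'"
    "\<And>b b'. b \<in> B0 \<Longrightarrow> b' \<in> B \<Longrightarrow> deg_in F b \<le> deg_in F b'"
    using sum_face_minimizers[of A B A B "deg_in F"] deg_in_add by metis
  let ?l = Poly_Mapping.lookup
  have "\<exists>A' B'. sum_face A B A' B' \<and> A' \<subseteq> A0 \<and> B' \<subseteq> B0 \<and>
      (\<forall>i\<in>S. (\<forall>a\<in>A'. \<forall>a'\<in>A'. ?l a i = ?l a' i) \<and> (\<forall>b\<in>B'. \<forall>b'\<in>B'. ?l b i = ?l b' i))"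
    if "finite S" for S :: "'n set"
    using that
  proof (induction S)
    case empty
    show ?case using 0(1) by blast
  next
    case (insert j S)
    then obtain A' B' where A': "sum_face A B A' B'" "A' \<subseteq> A0" "B' \<subseteq> B0"
      "\<forall>i\<in>S. (\<forall>a\<in>A'. \<forall>a'\<in>A'. ?l a i = ?l a' i) \<and> (\<forall>b\<in>B'. \<forall>b'\<in>B'. ?l b i = ?l b' i)"
      by blast
    obtain A'' B'' where A'': "sum_face A B A'' B''" "A'' \<subseteq> A'" "B'' \<subseteq> B'"
      "\<And>a a'. a \<in> A'' \<Longrightarrow> a' \<in> A' \<Longrightarrow> ?l a j \<le> ?l a' j"
      "\<And>b b'. b \<in> B'' \<Longrightarrow> b' \<in> B' \<Longrightarrow> ?l b j \<le> ?l b' j"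
      using sum_face_minimizers[OF A'(1), of "\<lambda>m. ?l m j"] lookup_add by metis
    have "\<forall>i\<in>insert j S. (\<forall>a\<in>A''. \<forall>a'\<in>A''. ?l a i = ?l a' i) \<and>
        (\<forall>b\<in>B''. \<forall>b'\<in>B''. ?l b i = ?l b' i)"
      using A'(4) A''(2-5) by (auto simp: subset_iff intro: order_antisym)
    then show ?case
      using A'(2,3) A''(1-3) by blast
  qed
  from this[of UNIV] obtain A' B' where
    A': "sum_face A B A' B'" "A' \<subseteq> A0" "B' \<subseteq> B0"
    and const: "\<forall>i. (\<forall>a\<in>A'. \<forall>a'\<in>A'. ?l a i = ?l a' i) \<and> (\<forall>b\<in>B'. \<forall>b'\<in>B'. ?l b i = ?l b' i)"
    by (simp only: finite ball_UNIV simp_thms) blast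
  from A'(1) obtain a b where ab: "a \<in> A'" "b \<in> B'" unfolding sum_face_def by blast
  show thesis
  proof (rule that)
    show "a \<in> A" "b \<in> B" using ab A'(1) by (auto simp: sum_face_def)
    show "a' = a \<and> b' = b" if *: "a' \<in> A" "b' \<in> B" "a' + b' = a + b" for a' b'
    proof -
      have "a' \<in> A'" "b' \<in> B'" using * ab A'(1) unfolding sum_face_def by blast+
      then show ?thesis using ab const by (blast intro: poly_mapping_eqI)
    qed
  qed (use 0 A' ab in blast)+
qed

lemma lookup_mult_unique_sum:
  fixes f g :: "('n, 'k::comm_ring_1) mpoly"
  assumes "\<And>a' b'. a' \<in> Poly_Mapping.keys f \<Longrightarrow> b' \<in> Poly_Mapping.keys g \<Longrightarrow>
    a' + b' = a + b \<Longrightarrow> a' = a \<and> b' = b"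
  shows "Poly_Mapping.lookup (f * g) (a + b) = Poly_Mapping.lookup f a * Poly_Mapping.lookup g b"
proof -
  define f' where "f' = f - Poly_Mapping.single a (Poly_Mapping.lookup f a)"
  define g' where "g' = g - Poly_Mapping.single b (Poly_Mapping.lookup g b)"
  have keys: "Poly_Mapping.keys f' \<subseteq> Poly_Mapping.keys f - {a}"
    "Poly_Mapping.keys g' \<subseteq> Poly_Mapping.keys g - {b}"
    by (auto simp: f'_def g'_def in_keys_iff lookup_minus lookup_single when_def split: if_splits)
  have "a + b \<notin> Poly_Mapping.keys (f' * g)"
  proof
    assume "a + b \<in> Poly_Mapping.keys (f' * g)"
    then obtain a' b' where "a + b = a' + b'" "a' \<in> Poly_Mapping.keys f'" "b' \<in> Poly_Mapping.keys g"
      using keys_mult[of f' g] by blast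
    then show False using assms[of a' b'] keys(1) by auto
  qed
  moreover have "a + b \<notin> Poly_Mapping.keys (Poly_Mapping.single a (Poly_Mapping.lookup f a) * g')"
  proof
    assume "a + b \<in> Poly_Mapping.keys (Poly_Mapping.single a (Poly_Mapping.lookup f a) * g')"
    then obtain a' b' where "a + b = a' + b'"
      "a' \<in> Poly_Mapping.keys (Poly_Mapping.single a (Poly_Mapping.lookup f a))"
      "b' \<in> Poly_Mapping.keys g'"
      using keys_mult[of "Poly_Mapping.single a (Poly_Mapping.lookup f a)" g'] by blast
    then have "a' = a" "b' \<in> Poly_Mapping.keys g'" by (simp_all split: if_splits)
    with \<open>a + b = a' + b'\<close> keys(2) show False by auto
  qed
  moreover have "f * g = f' * g + Poly_Mapping.single a (Poly_Mapping.lookup f a) * g' +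
      Poly_Mapping.single (a + b) (Poly_Mapping.lookup f a * Poly_Mapping.lookup g b)"
    by (simp add: f'_def g'_def algebra_simps mult_single)
  ultimately show ?thesis
    by (simp add: lookup_add in_keys_iff)
qed

text \<open>The least degree in \<open>F\<close> of a monomial is additive on products, since coefficients multiply without
  cancellation at the unique sum. Primeness and primariness both follow.\<close>

lemma mult_low_degree:
  fixes f g :: "('n::finite, 'k::field) mpoly"
  assumes "f \<notin> variable_power F (Suc c)" "g \<notin> variable_power F (Suc d)"
  shows "f * g \<notin> variable_power F (Suc (c + d))"
proof -
  obtain a0 b0 where 0: "a0 \<in> Poly_Mapping.keys f" "deg_in F a0 \<le> c"
    "b0 \<in> Poly_Mapping.keys g" "deg_in F b0 \<le> d"
    using assms by (auto simp: variable_power_def not_less_eq_eq)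
  have "Poly_Mapping.keys f \<noteq> {}" "Poly_Mapping.keys g \<noteq> {}"
    using 0(1,3) by auto
  then obtain a b where ab: "a \<in> Poly_Mapping.keys f" "b \<in> Poly_Mapping.keys g"
    "\<And>a' b'. a' \<in> Poly_Mapping.keys f \<Longrightarrow> b' \<in> Poly_Mapping.keys g \<Longrightarrow>
      a' + b' = a + b \<Longrightarrow> a' = a \<and> b' = b"
    and le: "\<And>a'. a' \<in> Poly_Mapping.keys f \<Longrightarrow> deg_in F a \<le> deg_in F a'"
    "\<And>b'. b' \<in> Poly_Mapping.keys g \<Longrightarrow> deg_in F b \<le> deg_in F b'"
    by (rule unique_sum_of_least_degree[of _ _ F]) (rule that)
  have "Poly_Mapping.lookup (f * g) (a + b) = Poly_Mapping.lookup f a * Poly_Mapping.lookup g b"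
    by (rule lookup_mult_unique_sum) (rule ab(3))
  then have "a + b \<in> Poly_Mapping.keys (f * g)"
    using ab(1,2) by (simp add: in_keys_iff)
  moreover have "deg_in F (a + b) \<le> c + d"
    using le(1)[OF 0(1)] le(2)[OF 0(3)] 0 by (simp add: deg_in_add)
  ultimately show ?thesis
    by (force simp: variable_power_def)
qed

lemma is_prime_ideal_variables:
  "is_prime_ideal (variable_power F 1 :: ('n::finite, 'k::field) mpoly set)"
  unfolding is_prime_ideal_def
proof (intro conjI allI impI)
  have "(1 :: ('n, 'k) mpoly) \<notin> variable_power F 1"
    by (auto simp: variable_power_def deg_in_def)
  then show "(variable_power F 1 :: ('n, 'k) mpoly set) \<noteq> UNIV" by blast
  show "a \<in> variable_power F 1 \<or> b \<in> variable_power F 1"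
    if "a * b \<in> variable_power F 1" for a b :: "('n, 'k) mpoly"
    using that mult_low_degree[of a F 0 b 0] by auto
qed (rule subspace_variable_power)

lemma variable_power_primary:
  fixes f g :: "('n::finite, 'k::field) mpoly"
  assumes "f * g \<in> variable_power F s" "f \<notin> variable_power F 1"
  shows "g \<in> variable_power F s"
  using assms mult_low_degree[of f F 0 g "s - 1"]
  by (cases s) (auto simp: variable_power_def)

text \<open>If \<open>f\<close> equals \<open>a / u\<close> in the localization, then \<open>t * u * f = t * a\<close> with \<open>t * u\<close> outside the
  prime, so \<open>f\<close> lies in every ideal that is primary to the prime and contains \<open>a\<close>.\<close>

lemma localized_contraction_subset_variable_power:
  assumes "J \<subseteq> variable_power F s"
  shows "localized_contraction (variable_power F 1) J
    \<subseteq> (variable_power F s :: ('n::finite, 'k::field) mpoly set)"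
proof
  let ?P = "variable_power F 1 :: ('n, 'k) mpoly set"
  fix f assume "f \<in> localized_contraction ?P J"
  then obtain a u where au: "a \<in> J" "u \<notin> ?P" "local_frac ?P f 1 = local_frac ?P a u"
    unfolding localized_contraction_def localized_ideal_def by blast
  have "((a, u), (a, u)) \<in> local_frac_rel ?P"
    using au(2) by (auto simp: local_frac_rel_def)
  then have "((f, 1), (a, u)) \<in> local_frac_rel ?P"
    using au(3) unfolding local_frac_def by blast
  then obtain t where t: "t \<notin> ?P" "t * (f * u - a * 1) = 0"
    unfolding local_frac_rel_def by blast
  then have "t * (f * u) = t * a" by (simp add: right_diff_distrib)
  then have "t * u * f = t * a" by (simp only: mult_ac)
  moreover have "t * a \<in> variable_power F s"
    using assms au(1) by (intro ideal.subspace_scale[OF subspace_variable_power]) auto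
  moreover have "t * u \<notin> ?P"
    using is_prime_ideal_variables t(1) au(2) unfolding is_prime_ideal_def by blast
  ultimately show "f \<in> variable_power F s"
    using variable_power_primary[of "t * u" f F s] by simp
qed

section \<open>Minimal covers, associated primes and symbolic powers\<close>

text \<open>Adding the variables of \<open>F\<close> one at a time gives a strict chain of primes.\<close>

lemma card_le_height_variables:
  fixes F :: "'n::finite set"
  shows "enat (card F) \<le> ideal_height (variable_power F 1 :: ('n, 'k::field) mpoly set)"
proof -
  obtain xs where xs: "set xs = F" "distinct xs"
    using finite_distinct_list[of F] by auto
  define c :: "nat \<Rightarrow> ('n, 'k) mpoly set" where "c i = variable_power (set (take i xs)) 1" for i
  have "c i \<subset> c (Suc i)" if i: "i < card F" for i
  proof (rule psubsetI)
    have len: "i < length xs" using i xs by (metis distinct_card)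
    have "deg_in (set (take i xs)) m \<le> deg_in (set (take (Suc i) xs)) m" for m
      unfolding deg_in_def by (intro sum_mono2) (auto simp: take_Suc_conv_app_nth len)
    then show "c i \<subseteq> c (Suc i)"
      unfolding c_def variable_power_def by (blast intro: order_trans)
    have notin: "xs ! i \<notin> set (take i xs)"
      using xs(2) len by (metis distinct_take id_take_nth_drop not_distinct_conv_prefix)
    let ?x = "monomial (Poly_Mapping.single (xs ! i) 1) :: ('n, 'k) mpoly"
    have "?x \<notin> c i"
      using notin by (auto simp: c_def variable_power_def deg_in_def lookup_single when_def)
    moreover have "?x \<in> c (Suc i)"
      using notin len
      by (auto simp: c_def variable_power_def deg_in_def lookup_single when_def take_Suc_conv_app_nth)
    ultimately show "c i \<noteq> c (Suc i)" by blast
  qed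
  moreover have "c (card F) = variable_power F 1"
    using xs by (simp add: c_def distinct_card[OF xs(2), symmetric])
  moreover have "is_prime_ideal (c i)" for i
    unfolding c_def by (rule is_prime_ideal_variables)
  ultimately show ?thesis
    unfolding ideal_height_def by (intro Sup_upper) blast
qed

lemma deg_in_eq_0_iff: "deg_in F m = 0 \<longleftrightarrow> Poly_Mapping.keys m \<inter> F = {}"
  for F :: "'n::finite set"
  by (auto simp: deg_in_def in_keys_iff)

text \<open>The product \<open>c\<close> of the variables outside \<open>F\<close> is the element whose annihilator modulo the ideal is the
  prime: multiplication by \<open>c\<close> makes all exponents outside \<open>F\<close> sufficient for a squarefree
  generator. So only the traces of the generators on \<open>F\<close> matter; they are nonempty because \<open>F\<close> is
  a cover, and all singletons occur among them by minimality.\<close>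

lemma minimal_cover_associated:
  fixes M :: "('n::finite \<Rightarrow>\<^sub>0 nat) set" and F :: "'n set"
  assumes "\<forall>m\<in>M. \<forall>i. Poly_Mapping.lookup m i \<le> 1"
    and F: "minimal_cover (Poly_Mapping.keys ` M) F"
  shows "variable_power F 1 \<in> associated_primes
    (ideal.span (monomial ` M) :: ('n, 'k::field) mpoly set)"
proof -
  define c where "c = (\<Sum>j\<in>-F. Poly_Mapping.single j (1::nat))"
  have c: "Poly_Mapping.lookup c i = (if i \<in> F then 0 else 1)" for i
    by (simp add: c_def lookup_sum lookup_single when_def)
  have iff: "(\<exists>g\<in>M. \<forall>i. Poly_Mapping.lookup g i \<le> Poly_Mapping.lookup (m + c) i) \<longleftrightarrow>
      1 \<le> deg_in F m" for m
  proof
    assume "\<exists>g\<in>M. \<forall>i. Poly_Mapping.lookup g i \<le> Poly_Mapping.lookup (m + c) i"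
    then obtain g where g: "g \<in> M" "\<And>i. Poly_Mapping.lookup g i \<le> Poly_Mapping.lookup (m + c) i"
      by blast
    then obtain i where i: "i \<in> F" "i \<in> Poly_Mapping.keys g"
      using F unfolding minimal_cover_def vertex_cover_def by blast
    then have "i \<in> Poly_Mapping.keys m"
      using g(2)[of i] by (auto simp: c lookup_add in_keys_iff)
    then have "deg_in F m \<noteq> 0"
      using i(1) unfolding deg_in_eq_0_iff by blast
    then show "1 \<le> deg_in F m" by simp
  next
    assume "1 \<le> deg_in F m"
    then have "deg_in F m \<noteq> 0" by simp
    then obtain i where i: "i \<in> Poly_Mapping.keys m" "i \<in> F"
      unfolding deg_in_eq_0_iff by blast
    obtain g where g: "g \<in> M" "Poly_Mapping.keys g \<inter> F = {i}"
      by (rule minimal_cover_private_edge[OF F i(2)]) (auto intro: that)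
    have "Poly_Mapping.lookup g j \<le> Poly_Mapping.lookup (m + c) j" for j
    proof (cases "j \<in> F")
      case True
      with g(2) have "j = i \<or> j \<notin> Poly_Mapping.keys g" by blast
      moreover have "1 \<le> Poly_Mapping.lookup m i"
        using i(1) by (simp add: in_keys_iff)
      ultimately show ?thesis
        using assms(1)[rule_format, OF g(1), of i]
        by (auto simp: lookup_add not_in_keys_iff_lookup_eq_zero)
    next
      case False
      then show ?thesis
        using assms(1)[rule_format, OF g(1), of j] by (simp add: lookup_add c)
    qed
    then show "\<exists>g\<in>M. \<forall>i. Poly_Mapping.lookup g i \<le> Poly_Mapping.lookup (m + c) i"
      by (intro bexI[OF _ g(1)] allI)
  qed
  have "variable_power F 1 = {a :: ('n, 'k) mpoly. a * monomial c \<in> ideal.span (monomial ` M)}"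
  proof (rule set_eqI)
    fix a :: "('n, 'k) mpoly"
    have "Poly_Mapping.lookup (a * monomial c) (m + c) = Poly_Mapping.lookup a m" for m
      using lookup_mult_unique_sum[of a "monomial c" m c] by (simp add: monomial_def)
    then have "m + c \<in> Poly_Mapping.keys (a * monomial c) \<longleftrightarrow> m \<in> Poly_Mapping.keys a" for m
      by (simp add: in_keys_iff)
    moreover have "Poly_Mapping.keys (a * monomial c) \<subseteq> range (\<lambda>m. m + c)"
      using keys_mult[of a "monomial c"] by auto
    ultimately have "Poly_Mapping.keys (a * monomial c) = (\<lambda>m. m + c) ` Poly_Mapping.keys a"
      by blast
    then show "a \<in> variable_power F 1 \<longleftrightarrow>
        a \<in> {a. a * monomial c \<in> ideal.span (monomial ` M)}"
      by (simp add: mem_span_monomials_iff iff variable_power_def)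
  qed
  then show ?thesis
    unfolding associated_primes_def using is_prime_ideal_variables by blast
qed

lemma card_minimal_cover_le_big_height:
  fixes M :: "('n::finite \<Rightarrow>\<^sub>0 nat) set" and F :: "'n set"
  assumes "\<forall>m\<in>M. \<forall>i. Poly_Mapping.lookup m i \<le> 1"
    and "minimal_cover (Poly_Mapping.keys ` M) F"
  shows "enat (card F) \<le> big_height (ideal.span (monomial ` M) :: ('n, 'k::field) mpoly set)"
  unfolding big_height_def
  using minimal_cover_associated[OF assms] card_le_height_variables by (rule SUP_upper2)

lemma symbolic_power_subset_variable_power:
  fixes M :: "('n::finite \<Rightarrow>\<^sub>0 nat) set" and F :: "'n set"
  assumes "\<forall>m\<in>M. \<forall>i. Poly_Mapping.lookup m i \<le> 1"
    and F: "minimal_cover (Poly_Mapping.keys ` M) F"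
  shows "symbolic_power (ideal.span (monomial ` M) :: ('n, 'k::field) mpoly set) s
    \<subseteq> variable_power F s"
proof -
  let ?I = "ideal.span (monomial ` M) :: ('n, 'k) mpoly set"
  have "1 \<le> deg_in F g" if "g \<in> M" for g
    using that F deg_in_eq_0_iff[of F g]
    unfolding minimal_cover_def vertex_cover_def by (metis imageI less_one not_le)
  then have "?I \<subseteq> variable_power F 1"
    by (intro ideal.span_minimal subspace_variable_power) (auto simp: variable_power_def)
  then have "ideal_power ?I s \<subseteq> variable_power F s"
    by (rule ideal_power_subset_variable_power)
  then have "localized_contraction (variable_power F 1) (ideal_power ?I s) \<subseteq> variable_power F s"
    by (rule localized_contraction_subset_variable_power)
  moreover have "symbolic_power ?I s \<subseteq> localized_contraction (variable_power F 1) (ideal_power ?I s)"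
    unfolding symbolic_power_def using minimal_cover_associated[OF assms] by (rule INT_lower)
  ultimately show ?thesis by (rule order_trans[rotated])
qed

section \<open>Containments of symbolic powers in ordinary powers\<close>

lemma subset_ideal_power_if_products_divide:
  fixes S :: "('n, 'k::comm_ring_1) mpoly set"
  assumes "\<And>f m. f \<in> S \<Longrightarrow> m \<in> Poly_Mapping.keys f \<Longrightarrow>
    \<exists>gs. set gs \<subseteq> M \<and> length gs = r \<and>
      (\<forall>i. Poly_Mapping.lookup (sum_list gs) i \<le> Poly_Mapping.lookup m i)"
  shows "S \<subseteq> ideal_power (ideal.span (monomial ` M)) r"
proof
  let ?I = "ideal.span (monomial ` M) :: ('n, 'k) mpoly set"
  fix f assume f: "f \<in> S"
  show "f \<in> ideal_power ?I r"
  proof (rule mem_subspace_if_monomials[OF subspace_ideal_power])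
    fix m assume "m \<in> Poly_Mapping.keys f"
    from assms[OF f this] obtain gs where gs: "set gs \<subseteq> M" "length gs = r"
      "\<And>i. Poly_Mapping.lookup (sum_list gs) i \<le> Poly_Mapping.lookup m i"
      by blast
    have "monomial (sum_list gs) \<in> ideal_power ?I (length gs)"
      using gs(1) by (intro monomial_sum_list_mem_ideal_power) (auto intro: ideal.span_base)
    then show "monomial m \<in> ideal_power ?I r"
      unfolding gs(2) by (rule monomial_multiple_mem[OF subspace_ideal_power _ gs(3)])
  qed
qed

lemma lookup_sum_list:
  "Poly_Mapping.lookup (sum_list gs) i = (\<Sum>g\<leftarrow>gs. Poly_Mapping.lookup g i)"
  by (induction gs) (simp_all add: lookup_add)

lemma sum_list_concat_replicate:
  "(\<Sum>x\<leftarrow>concat (map (\<lambda>v. replicate n (g v)) vs). \<phi> x) = n * (\<Sum>v\<leftarrow>vs. \<phi> (g v))"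
  for \<phi> :: "'a \<Rightarrow> nat"
  by (induction vs) (simp_all add: sum_list_replicate algebra_simps)

lemma symbolic_power_weights:
  fixes M :: "('n::finite \<Rightarrow>\<^sub>0 nat) set" and f :: "('n, 'k::field) mpoly"
  assumes "\<forall>m\<in>M. \<forall>i. Poly_Mapping.lookup m i \<le> 1"
    and "f \<in> symbolic_power (ideal.span (monomial ` M)) s" "m \<in> Poly_Mapping.keys f"
    and "minimal_cover (Poly_Mapping.keys ` M) F"
  shows "s \<le> (\<Sum>i\<in>F. Poly_Mapping.lookup m i)"
  using symbolic_power_subset_variable_power[OF assms(1,4), of s] assms(2,3)
  by (auto simp: variable_power_def deg_in_def)

lemma symbolic_power_subset_power_pigeonhole:
  fixes M :: "('n::finite \<Rightarrow>\<^sub>0 nat) set"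
  assumes sqf: "\<forall>m\<in>M. \<forall>i. Poly_Mapping.lookup m i \<le> 1"
    and small: "\<And>F. minimal_cover (Poly_Mapping.keys ` M) F \<Longrightarrow> card F \<le> k"
    and s: "k * (r - 1) + 1 \<le> s" and r: "1 \<le> r"
  shows "symbolic_power (ideal.span (monomial ` M) :: ('n, 'k::field) mpoly set) s
    \<subseteq> ideal_power (ideal.span (monomial ` M)) r"
proof (rule subset_ideal_power_if_products_divide)
  fix f :: "('n, 'k) mpoly" and m
  assume f: "f \<in> symbolic_power (ideal.span (monomial ` M)) s" "m \<in> Poly_Mapping.keys f"
  obtain e where e: "e \<in> Poly_Mapping.keys ` M" "\<And>i. i \<in> e \<Longrightarrow> r \<le> Poly_Mapping.lookup m i"
    by (rule edge_of_large_weights[of "Poly_Mapping.keys ` M" k r "Poly_Mapping.lookup m"])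
      (use small r order_trans[OF s symbolic_power_weights[OF sqf f]] in auto)
  then obtain g where g: "g \<in> M" "e = Poly_Mapping.keys g" by blast
  have "r * Poly_Mapping.lookup g i \<le> Poly_Mapping.lookup m i" for i
  proof (cases "i \<in> e")
    case True
    then show ?thesis
      using e(2)[OF True] mult_le_mono2[OF sqf[rule_format, OF g(1), of i], of r] by linarith
  qed (simp add: g(2) in_keys_iff)
  then show "\<exists>gs. set gs \<subseteq> M \<and> length gs = r \<and>
      (\<forall>i. Poly_Mapping.lookup (sum_list gs) i \<le> Poly_Mapping.lookup m i)"
    using g(1) by (intro exI[of _ "replicate r g"]) (auto simp: lookup_sum_list sum_list_replicate)
qed

lemma symbolic_power_subset_power_scaled:
  fixes M :: "('n::finite \<Rightarrow>\<^sub>0 nat) set"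
  assumes sqf: "\<forall>m\<in>M. \<forall>i. Poly_Mapping.lookup m i \<le> 1"
    and small: "\<And>F. minimal_cover (Poly_Mapping.keys ` M) F \<Longrightarrow> card F \<le> k"
    and s: "n * (k * CARD('n) - 1) + 1 \<le> s + k"
    and "2 \<le> k" "2 \<le> CARD('n)" "1 \<le> n"
  shows "symbolic_power (ideal.span (monomial ` M) :: ('n, 'k::field) mpoly set) s
    \<subseteq> ideal_power (ideal.span (monomial ` M)) (n * CARD('n))"
proof (rule subset_ideal_power_if_products_divide)
  fix f :: "('n, 'k) mpoly" and m
  assume f: "f \<in> symbolic_power (ideal.span (monomial ` M)) s" "m \<in> Poly_Mapping.keys f"
  obtain e :: "'n \<Rightarrow> 'n set" where e: "\<And>v. e v \<in> Poly_Mapping.keys ` M"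
    "\<And>i. n * card {v. i \<in> e v} \<le> Poly_Mapping.lookup m i"
  proof (rule edges_within_scaled_weights[of "Poly_Mapping.keys ` M" k n "Poly_Mapping.lookup m"])
    fix F assume "minimal_cover (Poly_Mapping.keys ` M) F"
    then show "n * (k * CARD('n) - 1) + 1 \<le> sum (Poly_Mapping.lookup m) F + k"
      using s symbolic_power_weights[OF sqf f, of F] by linarith
  qed (use assms in blast)+
  have "\<exists>g. g \<in> M \<and> Poly_Mapping.keys g = e v" for v
    using e(1)[of v] by auto
  then obtain g where g: "\<And>v. g v \<in> M" "\<And>v. Poly_Mapping.keys (g v) = e v" by metis
  obtain vs :: "'n list" where vs: "set vs = UNIV" "distinct vs"
    using finite_distinct_list[of "UNIV :: 'n set"] by auto
  define gs where "gs = concat (map (\<lambda>v. replicate n (g v)) vs)"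
  have "set gs \<subseteq> M" using g(1) by (auto simp: gs_def)
  moreover have "length vs = CARD('n)"
    using vs by (metis distinct_card)
  then have "length gs = n * CARD('n)"
    using sum_list_concat_replicate[of "\<lambda>_. 1" n g vs] by (simp add: gs_def sum_list_triv)
  moreover have "Poly_Mapping.lookup (sum_list gs) i \<le> Poly_Mapping.lookup m i" for i
  proof -
    have "Poly_Mapping.lookup (sum_list gs) i = n * (\<Sum>v\<in>UNIV. Poly_Mapping.lookup (g v) i)"
      unfolding gs_def lookup_sum_list sum_list_concat_replicate
      using vs by (simp add: sum_list_distinct_conv_sum_set)
    also have "(\<Sum>v\<in>UNIV. Poly_Mapping.lookup (g v) i) \<le> (\<Sum>v\<in>UNIV. of_bool (i \<in> e v))"
      using sqf g by (intro sum_mono) (auto simp: in_keys_iff simp flip: g(2))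
    also have "\<dots> = card {v. i \<in> e v}"
      by simp
    finally show ?thesis using e(2)[of i] by simp
  qed
  ultimately show "\<exists>gs. set gs \<subseteq> M \<and> length gs = n * CARD('n) \<and>
      (\<forall>i. Poly_Mapping.lookup (sum_list gs) i \<le> Poly_Mapping.lookup m i)"
    by blast
qed

section \<open>The resurgence bounds\<close>

text \<open>The square of \<open>l\<close> times the first inequality plus the second: the terms free of \<open>r\<close> and \<open>s\<close> then
  add up to \<open>1 - l - 2 * h * l\<close>, which is not positive.\<close>

lemma ratio_bound:
  fixes s r h l :: nat
  assumes "s \<le> h * (r - 1)"
    and 1: "real l * (real s + real h) \<le> (real r + real l - 1) * (real h * real l - 1)"
    and r: "1 \<le> r" and l: "1 \<le> l"
  shows "real s / real r \<le> real h - 1 / (real l + (real l)\<^sup>2)"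
proof -
  have "real s \<le> real (h * (r - 1))"
    using assms(1) by (rule of_nat_mono)
  also have "\<dots> = real h * (real r - 1)"
    using r by (simp add: of_nat_diff)
  finally have 2: "(real l)\<^sup>2 * real s \<le> (real l)\<^sup>2 * (real h * (real r - 1))"
    by (rule mult_left_mono) simp
  have "((real l + (real l)\<^sup>2) * real h - 1) * real r - real s * (real l + (real l)\<^sup>2) =
      ((real r + real l - 1) * (real h * real l - 1) - real l * (real s + real h)) +
      ((real l)\<^sup>2 * (real h * (real r - 1)) - (real l)\<^sup>2 * real s) +
      (2 * (real h * real l) + real l - 1)"
    by algebra
  moreover have "1 \<le> real l" "0 \<le> real h * real l" using l by simp_all
  ultimately have "real s * (real l + (real l)\<^sup>2) \<le> ((real l + (real l)\<^sup>2) * real h - 1) * real r"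
    using 1 2 by linarith
  moreover have pos: "0 < real l + (real l)\<^sup>2" using l by (simp add: add_pos_pos)
  ultimately have "real s / real r \<le>
      ((real l + (real l)\<^sup>2) * real h - 1) / (real l + (real l)\<^sup>2)"
    using r by (simp add: pos_divide_le_eq pos_le_divide_eq)
  also have "\<dots> = real h - 1 / (real l + (real l)\<^sup>2)"
    using pos by (simp add: diff_divide_distrib)
  finally show ?thesis .
qed

theorem corollary4p20:
  fixes I :: "('n::finite, 'k::field) mpoly set" and h :: nat
  assumes "squarefree_monomial_ideal I"
    and "big_height I = enat h"
    and "h \<ge> 2"
  shows "resurgence I < ereal (real h) \<and>
    asymptotic_resurgence I \<le> ereal ((real h * real CARD('n) - 1) / real CARD('n)) \<and>
    (real h * real CARD('n) - 1) / real CARD('n) = real h - 1 / real CARD('n)"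
proof -
  define l where "l = CARD('n)"
  have l: "1 \<le> l" by (simp add: l_def Suc_leI)
  have hl: "1 \<le> h * l" using l assms(3) by (simp add: Suc_leI)
  obtain M where sqf: "\<forall>m\<in>M. \<forall>i. Poly_Mapping.lookup m i \<le> 1" and I: "I = ideal.span (monomial ` M)"
    using assms(1) unfolding squarefree_monomial_ideal_def by blast
  have small: "card F \<le> h" if "minimal_cover (Poly_Mapping.keys ` M) F" for F
    using card_minimal_cover_le_big_height[OF sqf that, where 'k='k] assms(2) by (simp add: I)
  have pigeonhole_bound: "s \<le> h * (r - 1)"
    if "1 \<le> r" "\<not> symbolic_power I s \<subseteq> ideal_power I r" for s r
  proof (rule ccontr)
    assume "\<not> ?thesis"
    then have "h * (r - 1) + 1 \<le> s" by simp
    then have "symbolic_power I s \<subseteq> ideal_power I r"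
      unfolding I using small that(1)
      by (intro symbolic_power_subset_power_pigeonhole[OF sqf])
    with that(2) show False by blast
  qed
  have scaled_bound: "s + h \<le> n * (h * l - 1)"
    if "2 \<le> l" "1 \<le> n" "r \<le> n * l" "\<not> symbolic_power I s \<subseteq> ideal_power I r" for s r n
  proof (rule ccontr)
    assume "\<not> ?thesis"
    then have "n * (h * l - 1) + 1 \<le> s + h" by simp
    then have "symbolic_power I s \<subseteq> ideal_power I (n * l)"
      unfolding I using small that(1,2) assms(3) unfolding l_def
      by (intro symbolic_power_subset_power_scaled[OF sqf])
    also have "\<dots> \<subseteq> ideal_power I r"
      using that(3) by (rule ideal_power_antimono)
    finally show False using that(4) by blast
  qed
  \<comment> \<open>For a single variable the covers have at most one element, whatever \<open>h\<close> is, and the pigeonhole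
    containment with \<open>1\<close> in place of \<open>h\<close> is strong enough.\<close>
  have one_variable_bound: "s \<le> r - 1"
    if "l = 1" "1 \<le> r" "\<not> symbolic_power I s \<subseteq> ideal_power I r" for s r
  proof (rule ccontr)
    assume "\<not> ?thesis"
    then have s: "1 * (r - 1) + 1 \<le> s" by simp
    have "card F \<le> 1" for F :: "'n set"
      using card_mono[of UNIV F] that(1) by (simp add: l_def)
    then have "symbolic_power I s \<subseteq> ideal_power I r"
      unfolding I using s that(2) by (intro symbolic_power_subset_power_pigeonhole[OF sqf])
    with that(3) show False by blast
  qed

  have rho: "real s / real r \<le> real h - 1 / (real l + (real l)\<^sup>2)"
    if r: "1 \<le> r" and no: "\<not> symbolic_power I s \<subseteq> ideal_power I r" for s r
  proof (cases "l = 1")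
    case True
    have "real s / real r \<le> 1"
      using one_variable_bound[OF True r no] r by simp
    also have "1 \<le> real h - 1 / (real l + (real l)\<^sup>2)"
      using True assms(3) by simp
    finally show ?thesis .
  next
    case False
    then have l2: "2 \<le> l" using l by simp
    \<comment> \<open>\<open>n = \<lceil>r / l\<rceil>\<close>, the least \<open>n\<close> with \<open>r \<le> n * l\<close>\<close>
    define n where "n = (r + (l - 1)) div l"
    have "n * l \<le> r + (l - 1)" by (simp add: n_def)
    have "r + (l - 1) < n * l + l"
      using l dividend_less_times_div[of l "r + (l - 1)"] by (simp add: n_def algebra_simps)
    then have n: "r \<le> n * l" using l by linarith
    then have "1 \<le> n" using r by (cases n) auto
    from scaled_bound[OF l2 this n no] have "l * (s + h) \<le> n * l * (h * l - 1)"
      by (simp add: mult_ac)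
    also have "\<dots> \<le> (r + (l - 1)) * (h * l - 1)"
      using \<open>n * l \<le> r + (l - 1)\<close> by (rule mult_le_mono1)
    finally have "real (l * (s + h)) \<le> real ((r + (l - 1)) * (h * l - 1))"
      by (rule of_nat_mono)
    also have "\<dots> = (real r + real l - 1) * (real h * real l - 1)"
      using l hl by (simp add: of_nat_diff)
    finally have 1: "real l * (real s + real h) \<le> (real r + real l - 1) * (real h * real l - 1)"
      by simp
    have "s \<le> h * (r - 1)" using r no by (rule pigeonhole_bound)
    with 1 show ?thesis using r l by (intro ratio_bound)
  qed
  have "resurgence I \<le> ereal (real h - 1 / (real l + (real l)\<^sup>2))"
    unfolding resurgence_def
  proof (rule Sup_least, elim CollectE exE conjE)
    fix x s r assume x: "x = ereal (real s / real r)"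
      and sr: "1 \<le> r" "\<not> symbolic_power I s \<subseteq> ideal_power I r"
    show "x \<le> ereal (real h - 1 / (real l + (real l)\<^sup>2))"
      unfolding x ereal_less_eq(3) using sr by (rule rho)
  qed
  also have "\<dots> < ereal (real h)"
    using l by (simp add: add_pos_pos)
  finally have *: "resurgence I < ereal (real h)" .

  have rho_hat: "real s / real r \<le> (real h * real l - 1) / real l"
    if r: "1 \<le> r" and ev: "\<forall>\<^sub>F t in sequentially. \<not> symbolic_power I (s * t) \<subseteq> ideal_power I (r * t)"
    for s r
  proof -
    obtain N where N: "\<And>t. N \<le> t \<Longrightarrow> \<not> symbolic_power I (s * t) \<subseteq> ideal_power I (r * t)"
      using ev unfolding eventually_sequentially by blast
    \<comment> \<open>a multiple of \<open>l\<close>, so that \<open>r * t\<close> has the form \<open>n * l\<close>\<close>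
    define t where "t = l * Suc N"
    have t: "N \<le> t" "0 < t" using l by (cases l; auto simp: t_def)+
    show ?thesis
    proof (cases "l = 1")
      case True
      have "1 \<le> r * t" using r t(2) by (simp add: Suc_leI)
      then have "s * t \<le> r * t - 1" using N[OF t(1)] by (rule one_variable_bound[OF True])
      then have "s * t \<le> r * t" by (rule order_trans) (rule diff_le_self)
      then have "s \<le> r" using t(2) by simp
      then have "real s / real r \<le> 1" using r by simp
      also have "1 \<le> (real h * real l - 1) / real l" using True assms(3) by simp
      finally show ?thesis .
    next
      case False
      have "s * t + h \<le> (r * Suc N) * (h * l - 1)"
        by (rule scaled_bound[OF _ _ _ N[OF t(1)]]) (use False l r in \<open>simp_all add: t_def algebra_simps\<close>)
      then have "s * t \<le> (r * Suc N) * (h * l - 1)" by (rule add_leD1)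
      then have "(s * l) * Suc N \<le> (r * (h * l - 1)) * Suc N"
        by (simp only: t_def mult_ac)
      then have "s * l \<le> r * (h * l - 1)"
        unfolding mult_le_cancel2 by simp
      then have "real (s * l) \<le> real (r * (h * l - 1))" by (rule of_nat_mono)
      also have "\<dots> = (real h * real l - 1) * real r"
        using hl by (simp add: of_nat_diff)
      finally have "real s * real l \<le> (real h * real l - 1) * real r" by simp
      then show ?thesis using l r by (simp add: pos_divide_le_eq pos_le_divide_eq)
    qed
  qed
  have "asymptotic_resurgence I \<le> ereal ((real h * real l - 1) / real l)"
    unfolding asymptotic_resurgence_def
  proof (rule Sup_least, elim CollectE exE conjE)
    fix x s r assume x: "x = ereal (real s / real r)" and sr: "1 \<le> r"
      "\<forall>\<^sub>F t in sequentially. \<not> symbolic_power I (s * t) \<subseteq> ideal_power I (r * t)"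
    show "x \<le> ereal ((real h * real l - 1) / real l)"
      unfolding x ereal_less_eq(3) using sr by (rule rho_hat)
  qed
  moreover have "(real h * real l - 1) / real l = real h - 1 / real l"
    using l by (simp add: field_simps)
  ultimately show ?thesis using * by (simp add: l_def)
qed

end
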